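(* For any $L$, $m$ such that $L>m>0$, define $$\bar\alpha(\beta)=\begin{cases}\dfrac{2(1+\beta)}{L}, & \beta\le\left(\sqrt{\frac Lm}-\sqrt{\frac Lm-1}\right)^2,\\[3mm] \dfrac{2(1-\beta)^2}{(1+\beta)(L+m)-4\sqrt{\beta Lm}}, & \beta>\left(\sqrt{\frac Lm}-\sqrt{\frac Lm-1}\right)^2.\end{cases}$$ If $$0\le\beta<1,\qquad 0<\alpha<\bar\alpha(\beta),$$ then the algorithm $$x_{t+1}=x_t-\alpha\nabla f(x_t)+\beta(x_t-x_{t-1}),\qquad t=0,1,\ldots,$$ globally asymptotically converges to $x^*$ for all functions $f:\mathbf{R}^n\to\mathbf{R}$ in $\mathcal{F}_{m,L}^1$, where $x^*$ is the minimizer of $f$ appearing in the definition of that class.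
   Context: **The class $\mathcal{F}_{m,L}^1$.** For constants $L\ge m>0$, $\mathcal{F}_{m,L}^1$ is the class of differentiable (possibly non-convex) functions $f:\mathbf{R}^n\to\mathbf{R}$ for which there is a point $x^*\in\mathbf{R}^n$ at which the minimum of $f$ is attained and such that for every $x\in\mathbf{R}^n$ $$\left(m(x-x^* )-\nabla f(x)\right)^T\left(L(x-x^* )-\nabla f(x)\right)\le 0 .$$ **Global asymptotic convergence.** Let $x_t$ denote the vector of iterates of the algorithm at step $t$, initiated at time $0$ with $x_0,x_{-1}$. The algorithm is said to converge globally asymptotically to $x^*$ if its iterates have the following properties: (a) for every $\epsilon>0$ there exists $\delta=\delta(\epsilon)>0$ such that $\|x_{-1}-x^*\|<\delta$, $\|x_0-x^*\|<\delta$ imply that $\|x_t-x^*\|<\epsilon$ for all $t\ge0$; and (b) $\lim_{t\to\infty}\|x_t-x^*\|=0$ uniformly in $x_0,x_{-1}$ for all $x_0,x_{-1}\in\mathbf{R}^n$.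
   Formalization: In (b), convergence is proved uniformly over every bounded set of initial pairs, not over all of R^n×R^n at once; the latter fails for f(x)=c‖x‖²/2 with m≤c≤L, c≠1/α, where each x_t is an unbounded linear function of the initial data. *)

theory Defs
  imports "HOL-Analysis.Analysis"
begin

definition gradient :: "(real ^ 'n \<Rightarrow> real) \<Rightarrow> real ^ 'n \<Rightarrow> real ^ 'n" where
  "gradient f x = (THE D. GDERIV f x :> D)"

lemma GDERIV_gradient:
  fixes f :: "real ^ 'n \<Rightarrow> real"
  assumes "f differentiable (at x)"
  shows "GDERIV f x :> gradient f x"
proof -
  obtain f' where f': "(f has_derivative f') (at x)"
    using assms unfolding differentiable_def by blast
  define D where "D = adjoint f' 1"
  have "f' = (\<lambda>h. h \<bullet> D)"
    using adjoint_works[OF has_derivative_linear[OF f'], of _ 1] by (simp add: D_def fun_eq_iff)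
  then have D: "GDERIV f x :> D"
    using f' unfolding gderiv_def by simp
  have "E = D" if "GDERIV f x :> E" for E
  proof -
    have "(\<lambda>h. h \<bullet> E) = (\<lambda>h. h \<bullet> D)"
      using that D unfolding gderiv_def by (rule has_derivative_unique)
    then have "\<forall>h. h \<bullet> E = h \<bullet> D"
      by (rule fun_cong[THEN allI])
    then show ?thesis
      by (simp only: vector_eq_ldot)
  qed
  with D show ?thesis
    unfolding gradient_def by (rule theI)
qed

text \<open>The role of \<open>x\<^sup>*\<close> is kept as an explicit argument, since the convergence claim refers
  to it.\<close>

definition sector_minimizer :: "real \<Rightarrow> real \<Rightarrow> (real ^ 'n \<Rightarrow> real) \<Rightarrow> real ^ 'n \<Rightarrow> bool" where
  "sector_minimizer m L f xs \<longleftrightarrow>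
     (\<forall>x. f xs \<le> f x) \<and>
     (\<forall>x. (m *\<^sub>R (x - xs) - gradient f x) \<bullet> (L *\<^sub>R (x - xs) - gradient f x) \<le> 0)"

definition sector_class :: "real \<Rightarrow> real \<Rightarrow> (real ^ 'n \<Rightarrow> real) set" where
  "sector_class m L = {f. (\<forall>x. f differentiable (at x)) \<and> (\<exists>xs. sector_minimizer m L f xs)}"

text \<open>\<open>heavy_ball \<alpha> \<beta> f a b t\<close> is the iterate \<open>x\<^sub>t\<close> started from \<open>x\<^sub>0 = a\<close> and \<open>x\<^sub>-\<^sub>1 = b\<close>.\<close>

fun heavy_ball ::
    "real \<Rightarrow> real \<Rightarrow> (real ^ 'n \<Rightarrow> real) \<Rightarrow> real ^ 'n \<Rightarrow> real ^ 'n \<Rightarrow> nat \<Rightarrow> real ^ 'n" where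
  "heavy_ball \<alpha> \<beta> f a b 0 = a"
| "heavy_ball \<alpha> \<beta> f a b (Suc 0) = a - \<alpha> *\<^sub>R gradient f a + \<beta> *\<^sub>R (a - b)"
| "heavy_ball \<alpha> \<beta> f a b (Suc (Suc t)) =
     heavy_ball \<alpha> \<beta> f a b (Suc t) - \<alpha> *\<^sub>R gradient f (heavy_ball \<alpha> \<beta> f a b (Suc t))
       + \<beta> *\<^sub>R (heavy_ball \<alpha> \<beta> f a b (Suc t) - heavy_ball \<alpha> \<beta> f a b t)"

text \<open>\<open>X a b t\<close> is the iterate at step \<open>t\<close> for the initial data \<open>x\<^sub>0 = a\<close>, \<open>x\<^sub>-\<^sub>1 = b\<close>. As usual for
  global uniform asymptotic stability, the convergence is uniform over every bounded set of
  initial data, however large. Uniformity over the whole space at once is not meant: it fails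
  already for \<open>f x = c * (norm x)\<^sup>2 / 2\<close> with \<open>\<beta> > 0\<close>, where the iterates are nonzero linear
  functions of the initial data.\<close>

definition globally_asymptotically_converges ::
    "('a::real_normed_vector \<Rightarrow> 'a \<Rightarrow> nat \<Rightarrow> 'a) \<Rightarrow> 'a \<Rightarrow> bool" where
  "globally_asymptotically_converges X xs \<longleftrightarrow>
     (\<forall>\<epsilon>>0. \<exists>\<delta>>0. \<forall>a b. norm (b - xs) < \<delta> \<longrightarrow> norm (a - xs) < \<delta> \<longrightarrow>
        (\<forall>t. norm (X a b t - xs) < \<epsilon>)) \<and>
     (\<forall>S. bounded S \<longrightarrow>
        uniform_limit S (\<lambda>t (a, b). norm (X a b t - xs)) (\<lambda>_. 0) sequentially)"

definition alpha_bar :: "real \<Rightarrow> real \<Rightarrow> real \<Rightarrow> real" where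
  "alpha_bar m L \<beta> =
     (if \<beta> \<le> (sqrt (L / m) - sqrt (L / m - 1))\<^sup>2
      then 2 * (1 + \<beta>) / L
      else 2 * (1 - \<beta>)\<^sup>2 / ((1 + \<beta>) * (L + m) - 4 * sqrt (\<beta> * L * m)))"

end

theory Submission
  imports Defs
begin

text \<open>
  Put \<open>y\<^sub>t = x\<^sub>t - x\<^sup>*\<close>, \<open>k = (L + m) / 2\<close>, \<open>\<rho> = \<alpha> (L - m) / 2\<close> and \<open>c = 1 + \<beta> - \<alpha> k\<close>. The sector
  condition says that \<open>\<nabla>f(x\<^sub>t)\<close> lies in the ball with centre \<open>k y\<^sub>t\<close> and radius
  \<open>\<parallel>y\<^sub>t\<parallel> (L - m) / 2\<close>, so that the algorithm satisfies
  \<open>\<parallel>y\<^sub>t\<^sub>+\<^sub>1 - c y\<^sub>t + \<beta> y\<^sub>t\<^sub>-\<^sub>1\<parallel> \<le> \<rho> \<parallel>y\<^sub>t\<parallel>\<close>,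
  a perturbation of a linear recurrence. The circle criterion suggests when this forces
  stability: on the unit circle, \<open>\<bar>z + \<beta> / z - c\<bar>\<close> has to stay above \<open>\<rho>\<close>, that is, the distance from the
  point \<open>c\<close> to an ellipse with semi-axes \<open>1 + \<beta>\<close> and \<open>1 - \<beta>\<close> has to exceed \<open>\<rho>\<close>. If the nearest
  point of the ellipse is a vertex on the real axis, this reads \<open>\<bar>c\<bar> + \<rho> < 1 + \<beta>\<close>; otherwise it reads
  \<open>4 \<beta> \<rho>\<^sup>2 < (1 - \<beta>)\<^sup>2 (4 \<beta> - c\<^sup>2)\<close>. The two branches of \<open>alpha_bar\<close> are these two conditions
  solved for \<open>\<alpha>\<close> (lemma \<open>frequency_condition\<close>).

  The criterion is turned into an explicit quadratic Lyapunov function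
  \<open>V(a, b) = (1 - p) \<parallel>a\<parallel>\<^sup>2 - c (1 - \<beta>) (a \<bullet> b) + (p - \<beta>\<^sup>2) \<parallel>b\<parallel>\<^sup>2\<close>.
  Its cross term is chosen so that
  \<open>F(a, b, d) = \<parallel>a - c b + \<beta> d\<parallel>\<^sup>2 - \<rho>\<^sup>2 \<parallel>b\<parallel>\<^sup>2 - V(a, b) + V(b, d)\<close>
  is invariant under exchanging \<open>a\<close> and \<open>d\<close>. Hence \<open>F\<close> splits into a multiple of
  \<open>\<parallel>a - d\<parallel>\<^sup>2\<close> and a form in the two vectors \<open>a + d\<close> and \<open>b\<close>, and positive definiteness of \<open>F\<close> amounts to
  two scalar inequalities on \<open>p\<close>, which the circle criterion makes solvable
  (lemma \<open>circle_certificate\<close>); with \<open>2 p < 1 + \<beta>\<^sup>2\<close> they also make \<open>V\<close> positive definite. Along the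
  iterates the first two terms of \<open>F\<close> add up to something nonpositive, so \<open>V\<close> decreases by at least \<open>F\<close>
  in every step. This gives geometric decay with constants that are independent of the initial data, which
  yields both parts of global asymptotic convergence.
\<close>

section \<open>Quadratic forms in two vectors\<close>

lemma quadratic_form_nonneg:
  fixes u v :: "'a::real_inner"
  assumes "0 < A" and "B\<^sup>2 \<le> A * C"
  shows "0 \<le> A * (u \<bullet> u) + 2 * B * (u \<bullet> v) + C * (v \<bullet> v)"
proof -
  have "A * (A * (u \<bullet> u) + 2 * B * (u \<bullet> v) + C * (v \<bullet> v)) =
      (A *\<^sub>R u + B *\<^sub>R v) \<bullet> (A *\<^sub>R u + B *\<^sub>R v) + (A * C - B\<^sup>2) * (v \<bullet> v)"
    by (simp add: algebra_simps inner_commute power2_eq_square)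
  also have "\<dots> \<ge> 0"
    using assms by simp
  finally show ?thesis
    using assms(1) by (simp add: zero_le_mult_iff)
qed

text \<open>The constant is the determinant divided by the trace, a lower bound of the smaller
  eigenvalue: subtracting it from the diagonal leaves a form with nonnegative determinant.\<close>

lemma quadratic_form_pos_def:
  fixes A B C :: real
  assumes "0 < A" and "B\<^sup>2 < A * C"
  obtains e where "0 < e"
    and "\<And>u v :: 'a::real_inner.
      e * (u \<bullet> u + v \<bullet> v) \<le> A * (u \<bullet> u) + 2 * B * (u \<bullet> v) + C * (v \<bullet> v)"
proof -
  define e where "e = (A * C - B\<^sup>2) / (A + C)"
  have "0 < A * C"
    using assms(2) zero_le_power2[of B] by linarith
  then have "0 < C"
    using assms(1) by (simp add: zero_less_mult_iff)
  then have e: "0 < e" and eAC: "e * (A + C) = A * C - B\<^sup>2"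
    using assms by (auto simp: e_def)
  have "(A - e) * (A + C) = A\<^sup>2 + B\<^sup>2"
    using eAC by (simp add: algebra_simps power2_eq_square)
  moreover have "0 < A\<^sup>2 + B\<^sup>2"
    using assms(1) by (simp add: add_pos_nonneg)
  ultimately have "0 < (A - e) * (A + C)"
    by simp
  then have Ae: "0 < A - e"
    using \<open>0 < A\<close> \<open>0 < C\<close> by (simp add: zero_less_mult_iff)
  have "(A - e) * (C - e) = B\<^sup>2 + e\<^sup>2"
    using eAC by (simp add: algebra_simps power2_eq_square)
  then have det: "B\<^sup>2 \<le> (A - e) * (C - e)"
    by simp
  have "e * (u \<bullet> u + v \<bullet> v) \<le> A * (u \<bullet> u) + 2 * B * (u \<bullet> v) + C * (v \<bullet> v)" for u v :: 'a
    using quadratic_form_nonneg[OF Ae det, of u v] by (simp add: algebra_simps)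
  with e that show thesis
    by blast
qed

lemma quadratic_form_bounded:
  fixes u v :: "'a::real_inner"
  shows "A * (u \<bullet> u) + 2 * B * (u \<bullet> v) + C * (v \<bullet> v) \<le>
    (\<bar>A\<bar> + \<bar>B\<bar> + \<bar>C\<bar>) * (u \<bullet> u + v \<bullet> v)"
proof -
  have "0 \<le> (u - v) \<bullet> (u - v)" and "0 \<le> (u + v) \<bullet> (u + v)"
    by (rule inner_ge_zero)+
  then have "2 * \<bar>u \<bullet> v\<bar> \<le> u \<bullet> u + v \<bullet> v"
    by (simp add: inner_add_left inner_add_right inner_diff_left inner_diff_right inner_commute[of v u])
  then have "\<bar>B\<bar> * (2 * \<bar>u \<bullet> v\<bar>) \<le> \<bar>B\<bar> * (u \<bullet> u + v \<bullet> v)"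
    by (intro mult_left_mono) auto
  moreover have "2 * B * (u \<bullet> v) \<le> \<bar>B\<bar> * (2 * \<bar>u \<bullet> v\<bar>)"
    using abs_ge_self[of "2 * B * (u \<bullet> v)"] by (simp add: abs_mult)
  moreover have "A * (u \<bullet> u) \<le> \<bar>A\<bar> * (u \<bullet> u)" and "C * (v \<bullet> v) \<le> \<bar>C\<bar> * (v \<bullet> v)"
    by (simp_all add: mult_right_mono)
  moreover have "0 \<le> \<bar>A\<bar> * (v \<bullet> v)" and "0 \<le> \<bar>C\<bar> * (u \<bullet> u)"
    by simp_all
  ultimately show ?thesis
    unfolding distrib_left distrib_right by linarith
qed

section \<open>The circle criterion for the heavy-ball recurrence\<close>

text \<open>The product \<open>(p + \<beta>) (1 + c\<^sup>2 + \<beta>\<^sup>2 - \<rho>\<^sup>2 - 2 p)\<close> is a concave quadratic in \<open>p\<close> with its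
  maximum at \<open>(c\<^sup>2 + (1 - \<beta>)\<^sup>2 - \<rho>\<^sup>2) / 4\<close>, where the last inequality reduces to the vertex
  condition \<open>\<bar>c\<bar> + \<rho> < 1 + \<beta>\<close>. If this point is not to the right of \<open>\<beta>\<close>, the supremum over \<open>p > \<beta>\<close> is
  approached at \<open>\<beta>\<close> itself, and the inequality there is the second condition.\<close>

lemma circle_certificate:
  fixes \<beta> c \<rho> :: real
  assumes "0 \<le> \<beta>" and "\<beta> < 1" and "0 \<le> \<rho>"
    and vertex: "\<bar>c\<bar> + \<rho> < 1 + \<beta>"
    and inner: "c\<^sup>2 + (1 + \<beta>)\<^sup>2 - \<rho>\<^sup>2 \<le> 8 * \<beta> \<Longrightarrow> 4 * \<beta> * \<rho>\<^sup>2 < (1 - \<beta>)\<^sup>2 * (4 * \<beta> - c\<^sup>2)"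
  obtains p where "\<beta> < p" and "2 * p < 1 + \<beta>\<^sup>2"
    and "c\<^sup>2 * (1 + \<beta>)\<^sup>2 / 2 < (p + \<beta>) * (1 + c\<^sup>2 + \<beta>\<^sup>2 - \<rho>\<^sup>2 - 2 * p)"
proof (cases "c\<^sup>2 + (1 + \<beta>)\<^sup>2 - \<rho>\<^sup>2 \<le> 8 * \<beta>")
  case False
  define E where "E = c\<^sup>2 + (1 + \<beta>)\<^sup>2 - \<rho>\<^sup>2"
  define p where "p = E / 4 - \<beta>"
  have "\<bar>c\<bar> < 1 + \<beta>"
    using vertex \<open>0 \<le> \<rho>\<close> by linarith
  then have "\<bar>c\<bar>\<^sup>2 < (1 + \<beta>)\<^sup>2"
    by (intro power_strict_mono) auto
  then have "E < 2 * (1 + \<beta>)\<^sup>2"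
    using zero_le_power2[of \<rho>] unfolding E_def power2_abs by linarith
  then have p_less: "2 * p < 1 + \<beta>\<^sup>2"
    by (simp add: p_def power2_eq_square algebra_simps)
  have "\<rho>\<^sup>2 < (1 + \<beta> - \<bar>c\<bar>)\<^sup>2"
    using vertex \<open>0 \<le> \<rho>\<close> by (intro power_strict_mono) auto
  then have "2 * (\<bar>c\<bar> * (1 + \<beta>)) < E"
    unfolding E_def by (simp add: power2_diff algebra_simps)
  then have "(2 * (\<bar>c\<bar> * (1 + \<beta>)))\<^sup>2 < E\<^sup>2"
    using assms(1) by (intro power_strict_mono) auto
  then have "4 * (c\<^sup>2 * (1 + \<beta>)\<^sup>2) < E\<^sup>2"
    by (simp add: power_mult_distrib)
  moreover have "(p + \<beta>) * (1 + c\<^sup>2 + \<beta>\<^sup>2 - \<rho>\<^sup>2 - 2 * p) = E\<^sup>2 / 8"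
    by (simp add: p_def E_def power2_eq_square field_simps)
  ultimately have "c\<^sup>2 * (1 + \<beta>)\<^sup>2 / 2 < (p + \<beta>) * (1 + c\<^sup>2 + \<beta>\<^sup>2 - \<rho>\<^sup>2 - 2 * p)"
    by linarith
  moreover have "\<beta> < p"
    using False by (simp add: p_def E_def)
  ultimately show thesis
    using p_less that by blast
next
  case True
  let ?g = "\<lambda>p. (p + \<beta>) * (1 + c\<^sup>2 + \<beta>\<^sup>2 - \<rho>\<^sup>2 - 2 * p)"
  have "0 < (1 - \<beta>)\<^sup>2"
    using \<open>\<beta> < 1\<close> by simp
  then have "2 * \<beta> < 1 + \<beta>\<^sup>2"
    by (simp add: power2_eq_square algebra_simps)
  moreover have "c\<^sup>2 * (1 + \<beta>)\<^sup>2 / 2 < ?g \<beta>"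
  proof -
    have "?g \<beta> = c\<^sup>2 * (1 + \<beta>)\<^sup>2 / 2 + ((1 - \<beta>)\<^sup>2 * (4 * \<beta> - c\<^sup>2) - 4 * \<beta> * \<rho>\<^sup>2) / 2"
      by (simp add: power2_eq_square field_simps)
    then show ?thesis
      using inner[OF True] by simp
  qed
  moreover have "(?g \<longlongrightarrow> ?g \<beta>) (at_right \<beta>)" and "((\<lambda>p. 2 * p) \<longlongrightarrow> 2 * \<beta>) (at_right \<beta>)"
    by (intro tendsto_intros)+
  ultimately have "eventually (\<lambda>p. \<beta> < p \<and> 2 * p < 1 + \<beta>\<^sup>2 \<and> c\<^sup>2 * (1 + \<beta>)\<^sup>2 / 2 < ?g p) (at_right \<beta>)"
    by (intro eventually_conj eventually_at_right_less order_tendstoD)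
  then have "\<exists>p. \<beta> < p \<and> 2 * p < 1 + \<beta>\<^sup>2 \<and> c\<^sup>2 * (1 + \<beta>)\<^sup>2 / 2 < ?g p"
    using eventually_happens trivial_limit_at_right_real by blast
  then show thesis
    using that by blast
qed

text \<open>The cross term is the only one that makes \<open>F\<close> symmetric under the exchange of its outer
  arguments. The three coefficients are written in the shape \<open>A\<close>, \<open>2 B\<close>, \<open>C\<close> of a quadratic form
  with matrix entries \<open>A\<close>, \<open>B\<close>, \<open>C\<close>, whose determinant is \<open>A C - B\<^sup>2\<close>.\<close>

definition lyapunov :: "real \<Rightarrow> real \<Rightarrow> real \<Rightarrow> 'a::real_inner \<Rightarrow> 'a \<Rightarrow> real" where
  "lyapunov \<beta> c p a b =
     (1 - p) * (a \<bullet> a) + 2 * (- c * (1 - \<beta>) / 2) * (a \<bullet> b) + (p - \<beta>\<^sup>2) * (b \<bullet> b)"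

text \<open>The certificate for \<open>F\<close> already contains what is needed for \<open>V\<close>. Dropping \<open>\<rho>\<close> from it and
  cancelling \<open>1 + \<beta>\<^sup>2 - 2 p\<close> gives \<open>c\<^sup>2 < 2 (p + \<beta>)\<close>, and the determinant of \<open>V\<close> exceeds the one for
  \<open>c\<^sup>2 = 2 (p + \<beta>)\<close>, which factors as \<open>(p - \<beta>) (1 + \<beta>\<^sup>2 - 2 p) / 2\<close>.\<close>

lemma lyapunov_pos_def:
  fixes \<beta> c \<rho> p :: real
  assumes "0 \<le> \<beta>" and "\<beta> < 1" and "\<beta> < p" and "2 * p < 1 + \<beta>\<^sup>2"
    and cert: "c\<^sup>2 * (1 + \<beta>)\<^sup>2 / 2 < (p + \<beta>) * (1 + c\<^sup>2 + \<beta>\<^sup>2 - \<rho>\<^sup>2 - 2 * p)"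
  obtains e where "0 < e"
    and "\<And>a b :: 'a::real_inner. e * (a \<bullet> a + b \<bullet> b) \<le> lyapunov \<beta> c p a b"
proof -
  have "0 \<le> (p + \<beta>) * \<rho>\<^sup>2"
    using assms by simp
  moreover have "(p + \<beta>) * (1 + c\<^sup>2 + \<beta>\<^sup>2 - \<rho>\<^sup>2 - 2 * p) - c\<^sup>2 * (1 + \<beta>)\<^sup>2 / 2 =
      (2 * (p + \<beta>) - c\<^sup>2) * (1 + \<beta>\<^sup>2 - 2 * p) / 2 - (p + \<beta>) * \<rho>\<^sup>2"
    by (simp add: power2_eq_square field_simps)
  ultimately have "0 < (2 * (p + \<beta>) - c\<^sup>2) * (1 + \<beta>\<^sup>2 - 2 * p)"
    using cert by linarith
  then have "c\<^sup>2 < 2 * (p + \<beta>)"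
    using \<open>2 * p < 1 + \<beta>\<^sup>2\<close> by (simp add: zero_less_mult_iff)
  then have "c\<^sup>2 * (1 - \<beta>)\<^sup>2 < 2 * (p + \<beta>) * (1 - \<beta>)\<^sup>2"
    using \<open>\<beta> < 1\<close> by (intro mult_strict_right_mono) auto
  moreover have "4 * ((1 - p) * (p - \<beta>\<^sup>2)) - 2 * (p + \<beta>) * (1 - \<beta>)\<^sup>2 =
      2 * ((p - \<beta>) * (1 + \<beta>\<^sup>2 - 2 * p))"
    by (simp add: power2_eq_square algebra_simps)
  moreover have "0 < (p - \<beta>) * (1 + \<beta>\<^sup>2 - 2 * p)"
    using assms by simp
  moreover have "4 * (- c * (1 - \<beta>) / 2)\<^sup>2 = c\<^sup>2 * (1 - \<beta>)\<^sup>2"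
    by (simp add: power_mult_distrib power_divide)
  ultimately have det: "(- c * (1 - \<beta>) / 2)\<^sup>2 < (1 - p) * (p - \<beta>\<^sup>2)"
    by linarith
  have "\<beta>\<^sup>2 < 1"
    using assms by (simp add: power_less_one_iff)
  then have "0 < 1 - p"
    using \<open>2 * p < 1 + \<beta>\<^sup>2\<close> by linarith
  then show thesis
    using quadratic_form_pos_def[OF _ det, where 'a='a] that unfolding lyapunov_def by blast
qed

text \<open>The exchange symmetry makes \<open>F\<close> block diagonal; the antisymmetric part contributes
  \<open>(p - \<beta>) / 2 \<parallel>a - d\<parallel>\<^sup>2\<close>. The parallelogram law recovers \<open>\<parallel>d\<parallel>\<^sup>2\<close> from \<open>a - d\<close> and \<open>a + d\<close>.\<close>

lemma lyapunov_decrease: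
  fixes \<beta> c \<rho> p :: real
  assumes "0 \<le> \<beta>" and "\<beta> < p"
    and cert: "c\<^sup>2 * (1 + \<beta>)\<^sup>2 / 2 < (p + \<beta>) * (1 + c\<^sup>2 + \<beta>\<^sup>2 - \<rho>\<^sup>2 - 2 * p)"
  obtains e where "0 < e"
    and "\<And>a b d :: 'a::real_inner.
      (a - c *\<^sub>R b + \<beta> *\<^sub>R d) \<bullet> (a - c *\<^sub>R b + \<beta> *\<^sub>R d) \<le> \<rho>\<^sup>2 * (b \<bullet> b) \<Longrightarrow>
      lyapunov \<beta> c p a b \<le> lyapunov \<beta> c p b d - e * (b \<bullet> b + d \<bullet> d)"
proof -
  have "4 * (- c * (1 + \<beta>) / 2)\<^sup>2 = c\<^sup>2 * (1 + \<beta>)\<^sup>2"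
    by (simp add: power_mult_distrib power_divide)
  then have det: "(- c * (1 + \<beta>) / 2)\<^sup>2 < (p + \<beta>) / 2 * (1 + c\<^sup>2 + \<beta>\<^sup>2 - \<rho>\<^sup>2 - 2 * p)"
    using cert by (simp add: field_simps)
  have "0 < (p + \<beta>) / 2"
    using assms by simp
  from quadratic_form_pos_def[OF this det, where 'a='a] obtain e where e: "0 < e"
    and bound: "\<And>u v :: 'a. e * (u \<bullet> u + v \<bullet> v) \<le> (p + \<beta>) / 2 * (u \<bullet> u)
      + 2 * (- c * (1 + \<beta>) / 2) * (u \<bullet> v) + (1 + c\<^sup>2 + \<beta>\<^sup>2 - \<rho>\<^sup>2 - 2 * p) * (v \<bullet> v)"
    by blast
  define e' where "e' = min e ((p - \<beta>) / 2)"
  have e': "0 < e'"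
    using e assms(2) by (simp add: e'_def)
  have e'_le: "e' \<le> e" "e' \<le> (p - \<beta>) / 2"
    unfolding e'_def by (rule min.cobounded1 min.cobounded2)+
  have "lyapunov \<beta> c p a b \<le> lyapunov \<beta> c p b d - e' * (b \<bullet> b + d \<bullet> d)"
    if small: "(a - c *\<^sub>R b + \<beta> *\<^sub>R d) \<bullet> (a - c *\<^sub>R b + \<beta> *\<^sub>R d) \<le> \<rho>\<^sup>2 * (b \<bullet> b)" for a b d :: 'a
  proof -
    let ?s = "(a + d) \<bullet> (a + d)" and ?n = "(a - d) \<bullet> (a - d)"
    let ?F = "(p - \<beta>) / 2 * ?n + ((p + \<beta>) / 2 * ?s
      + 2 * (- c * (1 + \<beta>) / 2) * ((a + d) \<bullet> b) + (1 + c\<^sup>2 + \<beta>\<^sup>2 - \<rho>\<^sup>2 - 2 * p) * (b \<bullet> b))"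
    have F: "(a - c *\<^sub>R b + \<beta> *\<^sub>R d) \<bullet> (a - c *\<^sub>R b + \<beta> *\<^sub>R d) - \<rho>\<^sup>2 * (b \<bullet> b)
        - lyapunov \<beta> c p a b + lyapunov \<beta> c p b d = ?F"
      unfolding lyapunov_def
      by (simp add: inner_add_left inner_add_right inner_diff_left inner_diff_right
          inner_commute[of b a] inner_commute[of d a] inner_commute[of d b]
          power2_eq_square field_simps)
    have parallelogram: "?s + ?n = 2 * (a \<bullet> a) + 2 * (d \<bullet> d)"
      by (simp add: algebra_simps inner_commute)
    then have "b \<bullet> b + d \<bullet> d \<le> ?n + (?s + b \<bullet> b)"
      using inner_ge_zero[of a] inner_ge_zero[of d] by linarith
    then have "e' * (b \<bullet> b + d \<bullet> d) \<le> e' * (?n + (?s + b \<bullet> b))"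
      using e' by (intro mult_left_mono) auto
    also have "\<dots> = e' * ?n + e' * (?s + b \<bullet> b)"
      by (rule distrib_left)
    also have "\<dots> \<le> (p - \<beta>) / 2 * ?n + e * (?s + b \<bullet> b)"
      using e'_le by (intro add_mono mult_right_mono) auto
    also have "\<dots> \<le> ?F"
      using bound[of "a + d" b] by (intro add_left_mono)
    finally show ?thesis
      using F small by linarith
  qed
  with e' that show thesis
    by blast
qed

text \<open>The sequence is indexed from the initial datum \<open>y\<^sub>-\<^sub>1\<close> on, so \<open>z t\<close> stands for \<open>y\<^sub>t\<^sub>-\<^sub>1\<close>.
  The constants come from the form only, not from the sequence.\<close>

lemma perturbed_recurrence_geometric_decay:
  fixes \<beta> c \<rho> :: real
  assumes "0 \<le> \<beta>" and "\<beta> < 1" and "0 \<le> \<rho>"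
    and vertex: "\<bar>c\<bar> + \<rho> < 1 + \<beta>"
    and inner: "c\<^sup>2 + (1 + \<beta>)\<^sup>2 - \<rho>\<^sup>2 \<le> 8 * \<beta> \<Longrightarrow> 4 * \<beta> * \<rho>\<^sup>2 < (1 - \<beta>)\<^sup>2 * (4 * \<beta> - c\<^sup>2)"
  obtains K q where "0 < K" and "0 \<le> q" and "q < 1"
    and "\<And>(z :: nat \<Rightarrow> 'a::real_inner) t.
      (\<And>t. norm (z (Suc (Suc t)) - c *\<^sub>R z (Suc t) + \<beta> *\<^sub>R z t) \<le> \<rho> * norm (z (Suc t))) \<Longrightarrow>
      (norm (z (Suc t)))\<^sup>2 \<le> K * q ^ t * ((norm (z 1))\<^sup>2 + (norm (z 0))\<^sup>2)"
proof -
  obtain p where p: "\<beta> < p" "2 * p < 1 + \<beta>\<^sup>2"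
    and cert: "c\<^sup>2 * (1 + \<beta>)\<^sup>2 / 2 < (p + \<beta>) * (1 + c\<^sup>2 + \<beta>\<^sup>2 - \<rho>\<^sup>2 - 2 * p)"
    using circle_certificate[OF assms] by blast
  obtain \<mu> where \<mu>: "0 < \<mu>"
    and lower: "\<And>a b :: 'a. \<mu> * (a \<bullet> a + b \<bullet> b) \<le> lyapunov \<beta> c p a b"
    using lyapunov_pos_def[OF assms(1,2) p cert] by blast
  obtain e where e: "0 < e"
    and decrease: "\<And>a b d :: 'a.
      (a - c *\<^sub>R b + \<beta> *\<^sub>R d) \<bullet> (a - c *\<^sub>R b + \<beta> *\<^sub>R d) \<le> \<rho>\<^sup>2 * (b \<bullet> b) \<Longrightarrow>
      lyapunov \<beta> c p a b \<le> lyapunov \<beta> c p b d - e * (b \<bullet> b + d \<bullet> d)"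
    using lyapunov_decrease[OF assms(1) p(1) cert] by blast
  \<comment> \<open>The summand \<open>e\<close> keeps the contraction factor nonnegative.\<close>
  define M where "M = \<bar>1 - p\<bar> + \<bar>- c * (1 - \<beta>) / 2\<bar> + \<bar>p - \<beta>\<^sup>2\<bar> + e"
  have M: "0 < M" "e \<le> M"
    using e by (auto simp: M_def)
  have upper: "lyapunov \<beta> c p a b \<le> M * (a \<bullet> a + b \<bullet> b)" for a b :: 'a
  proof -
    have "0 \<le> e * (a \<bullet> a + b \<bullet> b)"
      using e by simp
    then show ?thesis
      using quadratic_form_bounded[of "1 - p" a "- c * (1 - \<beta>) / 2" b "p - \<beta>\<^sup>2"]
      unfolding lyapunov_def M_def distrib_right[of _ e] by linarith
  qed
  define q where "q = 1 - e / M"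
  have q: "0 \<le> q" "q < 1"
    using e M by (auto simp: q_def)
  have "(norm (z (Suc t)))\<^sup>2 \<le> M / \<mu> * q ^ t * ((norm (z 1))\<^sup>2 + (norm (z 0))\<^sup>2)"
    if rec: "\<And>t. norm (z (Suc (Suc t)) - c *\<^sub>R z (Suc t) + \<beta> *\<^sub>R z t) \<le> \<rho> * norm (z (Suc t))"
    for z :: "nat \<Rightarrow> 'a" and t
  proof -
    let ?V = "\<lambda>t. lyapunov \<beta> c p (z (Suc t)) (z t)"
    have contract: "?V (Suc t) \<le> q * ?V t" for t
    proof -
      have "(norm (z (Suc (Suc t)) - c *\<^sub>R z (Suc t) + \<beta> *\<^sub>R z t))\<^sup>2 \<le> (\<rho> * norm (z (Suc t)))\<^sup>2"
        using rec[of t] by (intro power_mono) auto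
      then have "?V (Suc t) \<le> ?V t - e * (z (Suc t) \<bullet> z (Suc t) + z t \<bullet> z t)"
        by (intro decrease) (simp add: power_mult_distrib power2_norm_eq_inner)
      moreover have "e / M * ?V t \<le> e / M * (M * (z (Suc t) \<bullet> z (Suc t) + z t \<bullet> z t))"
        using e M upper by (intro mult_left_mono) auto
      ultimately show ?thesis
        using M by (simp add: q_def left_diff_distrib)
    qed
    have "?V t \<le> q ^ t * ?V 0"
    proof (induction t)
      case (Suc t)
      have "q * ?V t \<le> q * (q ^ t * ?V 0)"
        using Suc q by (intro mult_left_mono) auto
      with contract[of t] show ?case
        by (simp add: mult.assoc)
    qed simp
    also have "\<dots> \<le> q ^ t * (M * (z 1 \<bullet> z 1 + z 0 \<bullet> z 0))"
      using q upper[of "z 1" "z 0"] by (intro mult_left_mono) auto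
    finally have "\<mu> * (z (Suc t) \<bullet> z (Suc t) + z t \<bullet> z t) \<le> q ^ t * (M * (z 1 \<bullet> z 1 + z 0 \<bullet> z 0))"
      using lower[of "z (Suc t)" "z t"] by linarith
    moreover have "\<mu> * (z (Suc t) \<bullet> z (Suc t)) \<le> \<mu> * (z (Suc t) \<bullet> z (Suc t) + z t \<bullet> z t)"
      using \<mu> by simp
    ultimately have "\<mu> * (z (Suc t) \<bullet> z (Suc t)) \<le> q ^ t * (M * (z 1 \<bullet> z 1 + z 0 \<bullet> z 0))"
      by linarith
    then show ?thesis
      using \<mu> by (simp add: power2_norm_eq_inner field_simps)
  qed
  moreover have "0 < M / \<mu>"
    using M \<mu> by simp
  ultimately show thesis
    using q that by blast
qed

section \<open>Step sizes below the bound\<close>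

text \<open>With \<open>\<beta> = B\<^sup>2\<close> and \<open>T = sqrt (L / m)\<close>, the polynomial \<open>1 - 2 B T + B\<^sup>2\<close> has the roots
  \<open>T - sqrt (T\<^sup>2 - 1)\<close> and \<open>T + sqrt (T\<^sup>2 - 1)\<close>, whose product is \<open>1\<close>; the threshold for \<open>\<beta>\<close> is the
  square of the smaller one.\<close>

lemma momentum_threshold:
  fixes m L \<beta> :: real
  assumes "0 < m" and "m < L" and "0 \<le> \<beta>"
    and "\<beta> \<le> (sqrt (L / m) - sqrt (L / m - 1))\<^sup>2"
  shows "2 * sqrt \<beta> * sqrt L \<le> (1 + \<beta>) * sqrt m"
proof -
  define T U B where "T = sqrt (L / m)" and "U = sqrt (L / m - 1)" and "B = sqrt \<beta>"
  have "1 < L / m"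
    using assms by simp
  then have "T\<^sup>2 = L / m" and "U\<^sup>2 = L / m - 1" and "0 \<le> U" and "U \<le> T"
    by (auto simp: T_def U_def)
  then have TU: "T * T = U * U + 1"
    by (simp add: power2_eq_square)
  have B: "\<beta> = B * B"
    using assms by (simp add: B_def)
  have "sqrt \<beta> \<le> sqrt ((T - U)\<^sup>2)"
    using assms(4) unfolding T_def U_def by (rule real_sqrt_le_mono)
  then have "B \<le> T - U"
    using \<open>U \<le> T\<close> by (simp add: B_def)
  then have "0 \<le> (T - U - B) * (T + U - B)"
    using \<open>0 \<le> U\<close> by (intro mult_nonneg_nonneg) auto
  then have "2 * B * T \<le> 1 + \<beta>"
    using TU by (simp add: B algebra_simps)
  then have "2 * B * T * sqrt m \<le> (1 + \<beta>) * sqrt m"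
    using assms(1) by (intro mult_right_mono) auto
  then show ?thesis
    using assms(1) by (simp add: B_def T_def real_sqrt_divide)
qed

text \<open>The two conditions of the circle criterion. The vertex condition is \<open>\<alpha> L < 2 (1 + \<beta>)\<close>, which
  is also implied by the second branch of the bound because
  \<open>(2 sqrt (\<beta> L) - (1 + \<beta>) sqrt m)\<^sup>2 \<ge> 0\<close>.

  For the second condition, the difference of its two sides is
  \<open>4 \<beta> L m \<alpha>\<^sup>2 - ((1 - \<beta>)\<^sup>2 - \<alpha> (1 + \<beta>) k)\<^sup>2\<close>, so that it is equivalent to
  \<open>\<bar>(1 - \<beta>)\<^sup>2 - \<alpha> (1 + \<beta>) k\<bar> < 2 \<alpha> sqrt (\<beta> L m)\<close>. The vertex condition and the hypothesis of the
  second condition give \<open>\<bar>c\<bar> (1 + \<beta>) < 4 \<beta>\<close>, that is, the nearest point of the ellipse is not a vertex.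
  The bound on \<open>c\<close> from above gives \<open>(1 - \<beta>)\<^sup>2 < \<alpha> (1 + \<beta>) k\<close>, so that only the estimate of
  \<open>\<alpha> (1 + \<beta>) k - (1 - \<beta>)\<^sup>2\<close> from above is left. It is the second branch of the bound on \<open>\<alpha>\<close>; on the
  first branch it follows from the bound on \<open>c\<close> from below and the threshold for \<open>\<beta>\<close>.\<close>

lemma frequency_condition:
  fixes m L \<alpha> \<beta> :: real
  defines "c \<equiv> 1 + \<beta> - \<alpha> * ((L + m) / 2)" and "\<rho> \<equiv> \<alpha> * ((L - m) / 2)"
  assumes "0 < m" and "m < L" and "0 \<le> \<beta>" and "\<beta> < 1" and "0 < \<alpha>" and less: "\<alpha> < alpha_bar m L \<beta>"
  shows "\<bar>c\<bar> + \<rho> < 1 + \<beta>"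
    and "c\<^sup>2 + (1 + \<beta>)\<^sup>2 - \<rho>\<^sup>2 \<le> 8 * \<beta> \<Longrightarrow> 4 * \<beta> * \<rho>\<^sup>2 < (1 - \<beta>)\<^sup>2 * (4 * \<beta> - c\<^sup>2)"
proof -
  define B g h where "B = sqrt \<beta>" and "g = sqrt L" and "h = sqrt m"
  define k where "k = (L + m) / 2"
  define low where "low = (sqrt (L / m) - sqrt (L / m - 1))\<^sup>2"
  have B: "0 \<le> B" "\<beta> = B\<^sup>2" and g: "L = g\<^sup>2" and h: "0 < h" "m = h\<^sup>2" and gh: "h < g"
    using assms by (auto simp: B_def g_def h_def)
  have "B < 1"
    using \<open>\<beta> < 1\<close> by (simp add: B_def)
  have prods: "sqrt (\<beta> * L * m) = B * g * h"
    by (simp add: B_def g_def h_def real_sqrt_mult)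
  have k: "2 * k = g\<^sup>2 + h\<^sup>2"
    by (simp add: k_def g h)
  \<comment> \<open>Half the denominator of the second branch, written as a sum of squares.\<close>
  have rate_pos: "0 < (1 + \<beta>) * k - 2 * (B * g * h)"
  proof -
    have "0 < (g - h)\<^sup>2" and "0 \<le> (1 - B)\<^sup>2"
      using gh by auto
    then have "0 < (1 + B\<^sup>2) * (g - h)\<^sup>2" and "0 \<le> 2 * (g * h) * (1 - B)\<^sup>2"
      using gh h(1) by (auto intro!: mult_pos_pos mult_nonneg_nonneg add_pos_nonneg)
    then have "0 < (1 + B\<^sup>2) * (g - h)\<^sup>2 + 2 * (g * h) * (1 - B)\<^sup>2"
      by (rule add_pos_nonneg)
    also have "\<dots> = 2 * ((1 + B\<^sup>2) * k - 2 * (B * g * h))"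
    proof -
      have "2 * ((1 + B\<^sup>2) * k - 2 * (B * g * h)) = (1 + B\<^sup>2) * (2 * k) - 4 * (B * g * h)"
        by (simp add: algebra_simps)
      also have "\<dots> = (1 + B\<^sup>2) * (g - h)\<^sup>2 + 2 * (g * h) * (1 - B)\<^sup>2"
        unfolding k by (simp add: power2_eq_square algebra_simps)
      finally show ?thesis ..
    qed
    finally show ?thesis
      unfolding B(2) by (rule zero_less_mult_pos) simp
  qed
  have second_branch: "\<alpha> * ((1 + \<beta>) * k - 2 * (B * g * h)) < (1 - \<beta>)\<^sup>2" if "\<not> \<beta> \<le> low"
  proof -
    have "alpha_bar m L \<beta> = (1 - \<beta>)\<^sup>2 / ((1 + \<beta>) * k - 2 * (B * g * h))"
    proof -
      have "(1 + \<beta>) * (L + m) - 4 * sqrt (\<beta> * L * m) = 2 * ((1 + \<beta>) * k - 2 * (B * g * h))"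
        by (simp add: prods k_def)
      then have "alpha_bar m L \<beta> = 2 * (1 - \<beta>)\<^sup>2 / (2 * ((1 + \<beta>) * k - 2 * (B * g * h)))"
        using that unfolding alpha_bar_def low_def by (simp only: if_False)
      then show ?thesis
        by (simp only: mult_divide_mult_cancel_left_if zero_neq_numeral[symmetric] if_False)
    qed
    with less rate_pos show ?thesis
      by (simp add: pos_less_divide_eq)
  qed
  have \<alpha>L: "\<alpha> * L < 2 * (1 + \<beta>)"
  proof (cases "\<beta> \<le> low")
    case True
    then show ?thesis
      using less assms(3,4) by (simp add: alpha_bar_def low_def pos_less_divide_eq)
  next
    case False
    let ?D = "(1 + \<beta>) * k - 2 * (B * g * h)"
    have "2 * (1 + \<beta>) * ?D - (1 - \<beta>)\<^sup>2 * L = (2 * B * g - (1 + B\<^sup>2) * h)\<^sup>2"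
    proof -
      have "2 * (1 + \<beta>) * ?D = (1 + \<beta>) * ((1 + \<beta>) * (2 * k) - 4 * (B * g * h))"
        by (simp add: algebra_simps)
      then show ?thesis
        unfolding k by (simp add: B(2) g power2_eq_square algebra_simps)
    qed
    then have "(1 - \<beta>)\<^sup>2 * L \<le> 2 * (1 + \<beta>) * ?D"
      using zero_le_power2[of "2 * B * g - (1 + B\<^sup>2) * h"] by linarith
    moreover have "\<alpha> * ?D * L < (1 - \<beta>)\<^sup>2 * L"
      using second_branch[OF False] assms(3,4) by (intro mult_strict_right_mono) auto
    ultimately have "\<alpha> * L * ?D < 2 * (1 + \<beta>) * ?D"
      by (simp add: mult_ac)
    then show ?thesis
      using rate_pos by (simp add: mult_less_cancel_right)
  qed
  have "0 < \<alpha> * m"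
    using assms by simp
  then show vertex: "\<bar>c\<bar> + \<rho> < 1 + \<beta>"
    using \<alpha>L by (auto simp: c_def \<rho>_def abs_if algebra_simps add_divide_distrib diff_divide_distrib)
  show "4 * \<beta> * \<rho>\<^sup>2 < (1 - \<beta>)\<^sup>2 * (4 * \<beta> - c\<^sup>2)" if K: "c\<^sup>2 + (1 + \<beta>)\<^sup>2 - \<rho>\<^sup>2 \<le> 8 * \<beta>"
  proof -
    have "0 \<le> \<rho>"
      using assms by (simp add: \<rho>_def)
    then have "\<rho>\<^sup>2 < (1 + \<beta> - \<bar>c\<bar>)\<^sup>2"
      using vertex by (intro power_strict_mono) auto
    then have "2 * (\<bar>c\<bar> * (1 + \<beta>)) < 8 * \<beta>"
      using K by (simp add: power2_diff algebra_simps)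
    then have "\<bar>c * (1 + \<beta>)\<bar> < 4 * \<beta>"
      using assms(5) by (simp add: abs_mult)
    then have c_upper: "c * (1 + \<beta>) < 4 * \<beta>" and c_lower: "- (4 * \<beta>) < c * (1 + \<beta>)"
      by linarith+
    have c: "c = 1 + \<beta> - \<alpha> * k"
      by (simp add: c_def k_def)
    have "0 < \<beta>"
      using c_upper c_lower by linarith
    then have "0 < B"
      by (simp add: B_def)
    have "(1 - \<beta>)\<^sup>2 < \<alpha> * ((1 + \<beta>) * k)"
      using c_upper by (simp add: c power2_eq_square algebra_simps)
    moreover have lower: "\<alpha> * ((1 + \<beta>) * k - 2 * (B * g * h)) < (1 - \<beta>)\<^sup>2"
    proof (cases "\<beta> \<le> low")
      case True
      \<comment> \<open>The lower bound on \<open>c\<close> reads \<open>\<alpha> k a < a\<^sup>2 + b\<^sup>2\<close>. Inserting this upper bound for \<open>\<alpha>\<close> into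
        \<open>\<alpha> (a k - b g h) < a\<^sup>2 - b\<^sup>2\<close> and clearing denominators leaves, up to the factor \<open>b > 0\<close>, the inequality
        \<open>(a g - b h) (a h - b g) \<ge> 0\<close>, whose second factor is the threshold for \<open>\<beta>\<close>.\<close>
      define a b where "a = 1 + B\<^sup>2" and "b = 2 * B"
      have b_less_a: "b < a"
      proof -
        have "0 < (1 - B)\<^sup>2"
          using \<open>B < 1\<close> by simp
        then show ?thesis
          by (simp add: a_def b_def power2_eq_square algebra_simps)
      qed
      have ab: "0 < b" "a\<^sup>2 - b\<^sup>2 = (1 - \<beta>)\<^sup>2" "a\<^sup>2 + b\<^sup>2 = (1 + \<beta>)\<^sup>2 + 4 * \<beta>"
        using \<open>0 < B\<close> by (auto simp: a_def b_def B(2) power2_eq_square algebra_simps)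
      have "b * g \<le> a * h"
        using momentum_threshold[OF assms(3,4,5)] True
        by (simp add: low_def a_def b_def B_def g_def h_def assms(5))
      moreover have "b * h \<le> a * g"
        using b_less_a gh h(1) ab(1) by (intro mult_mono) auto
      ultimately have "0 \<le> (a * g - b * h) * (a * h - b * g)"
        by (intro mult_nonneg_nonneg) auto
      then have "0 \<le> b * ((a * g - b * h) * (a * h - b * g))"
        using ab(1) by simp
      also have "\<dots> = (a\<^sup>2 - b\<^sup>2) * (a * k) - (a\<^sup>2 + b\<^sup>2) * (a * k - b * (g * h))"
      proof -
        have "(a\<^sup>2 - b\<^sup>2) * (a * k) - (a\<^sup>2 + b\<^sup>2) * (a * k - b * (g * h)) =
            (a\<^sup>2 + b\<^sup>2) * (b * (g * h)) - a * b\<^sup>2 * (2 * k)"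
          by (simp add: algebra_simps)
        then show ?thesis
          unfolding k by (simp add: power2_eq_square algebra_simps)
      qed
      finally have "\<alpha> * ((a\<^sup>2 + b\<^sup>2) * (a * k - b * (g * h))) \<le> \<alpha> * ((a\<^sup>2 - b\<^sup>2) * (a * k))"
        using \<open>0 < \<alpha>\<close> by (intro mult_left_mono) auto
      also have "\<dots> = (a\<^sup>2 - b\<^sup>2) * (\<alpha> * k * a)"
        by (simp only: mult_ac)
      also have "\<dots> < (a\<^sup>2 - b\<^sup>2) * (a\<^sup>2 + b\<^sup>2)"
      proof (rule mult_strict_left_mono)
        show "\<alpha> * k * a < a\<^sup>2 + b\<^sup>2"
          using c_lower unfolding ab(3) by (simp add: c a_def B(2) power2_eq_square algebra_simps)
        show "0 < a\<^sup>2 - b\<^sup>2"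
          using \<open>\<beta> < 1\<close> ab(2) by simp
      qed
      finally have "(a\<^sup>2 + b\<^sup>2) * (\<alpha> * (a * k - b * (g * h))) < (a\<^sup>2 + b\<^sup>2) * (a\<^sup>2 - b\<^sup>2)"
        by (simp only: mult_ac)
      moreover have "0 < a\<^sup>2 + b\<^sup>2"
        using ab(1) by (simp add: add_nonneg_pos)
      ultimately have "\<alpha> * (a * k - b * (g * h)) < a\<^sup>2 - b\<^sup>2"
        by simp
      then show ?thesis
        unfolding ab(2) by (simp add: a_def b_def B(2) mult.assoc)
    qed (rule second_branch)
    ultimately have "0 < (2 * \<alpha> * (B * g * h) - (\<alpha> * ((1 + \<beta>) * k) - (1 - \<beta>)\<^sup>2)) *
        (2 * \<alpha> * (B * g * h) + (\<alpha> * ((1 + \<beta>) * k) - (1 - \<beta>)\<^sup>2))"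
      using \<open>0 < \<alpha>\<close> \<open>0 < B\<close> gh h(1)
      by (intro mult_pos_pos add_pos_pos) (auto simp: algebra_simps)
    also have "\<dots> = 4 * \<alpha>\<^sup>2 * (\<beta> * L * m) - (\<alpha> * ((1 + \<beta>) * k) - (1 - \<beta>)\<^sup>2)\<^sup>2"
      by (simp add: B(2) g h(2) power2_eq_square algebra_simps)
    also have "\<dots> = (1 - \<beta>)\<^sup>2 * (4 * \<beta> - c\<^sup>2) - 4 * \<beta> * \<rho>\<^sup>2"
      by (simp add: c \<rho>_def k_def power2_eq_square field_simps)
    finally show ?thesis
      by simp
  qed
qed

section \<open>Convergence of the heavy-ball iterates\<close>

lemma sector_minimizer_gradient_ball:
  assumes "sector_minimizer m L f xs" and "m \<le> L"
  shows "norm (gradient f x - ((L + m) / 2) *\<^sub>R (x - xs)) \<le> (L - m) / 2 * norm (x - xs)"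
proof (rule power2_le_imp_le)
  let ?y = "x - xs" and ?u = "gradient f x"
  have "(m *\<^sub>R ?y - ?u) \<bullet> (L *\<^sub>R ?y - ?u) \<le> 0"
    using assms(1) by (simp add: sector_minimizer_def)
  moreover have "(?u - ((L + m) / 2) *\<^sub>R ?y) \<bullet> (?u - ((L + m) / 2) *\<^sub>R ?y) =
      ((L - m) / 2)\<^sup>2 * (?y \<bullet> ?y) + (m *\<^sub>R ?y - ?u) \<bullet> (L *\<^sub>R ?y - ?u)"
  proof -
    have "(u - ((L + m) / 2) *\<^sub>R y) \<bullet> (u - ((L + m) / 2) *\<^sub>R y) =
      ((L - m) / 2)\<^sup>2 * (y \<bullet> y) + (m *\<^sub>R y - u) \<bullet> (L *\<^sub>R y - u)" for u y :: "real ^ 'n"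
      by (simp add: inner_diff_left inner_diff_right inner_commute[of u y]
          power2_eq_square field_simps)
    then show ?thesis .
  qed
  ultimately show "(norm (?u - ((L + m) / 2) *\<^sub>R ?y))\<^sup>2 \<le> ((L - m) / 2 * norm ?y)\<^sup>2"
    unfolding power_mult_distrib power2_norm_eq_inner by linarith
qed (use assms(2) in simp)

lemma heavy_ball_perturbed_recurrence:
  fixes f :: "real ^ 'n \<Rightarrow> real" and xs a b :: "real ^ 'n" and \<alpha> \<beta> :: real
  assumes "sector_minimizer m L f xs" and "m \<le> L" and "0 \<le> \<alpha>"
  defines "z \<equiv> \<lambda>t. (case t of 0 \<Rightarrow> b | Suc s \<Rightarrow> heavy_ball \<alpha> \<beta> f a b s) - xs"
  shows "norm (z (Suc (Suc t)) - (1 + \<beta> - \<alpha> * ((L + m) / 2)) *\<^sub>R z (Suc t) + \<beta> *\<^sub>R z t)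
    \<le> \<alpha> * ((L - m) / 2) * norm (z (Suc t))"
proof -
  define x where "x = heavy_ball \<alpha> \<beta> f a b t"
  have "z (Suc (Suc t)) = z (Suc t) - \<alpha> *\<^sub>R gradient f x + \<beta> *\<^sub>R (z (Suc t) - z t)"
    by (cases t) (simp_all add: z_def x_def algebra_simps)
  then have "z (Suc (Suc t)) - (1 + \<beta> - \<alpha> * ((L + m) / 2)) *\<^sub>R z (Suc t) + \<beta> *\<^sub>R z t =
      - (\<alpha> *\<^sub>R (gradient f x - ((L + m) / 2) *\<^sub>R z (Suc t)))"
    by (simp add: algebra_simps)
  then have "norm (z (Suc (Suc t)) - (1 + \<beta> - \<alpha> * ((L + m) / 2)) *\<^sub>R z (Suc t) + \<beta> *\<^sub>R z t) =
      \<alpha> * norm (gradient f x - ((L + m) / 2) *\<^sub>R z (Suc t))"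
    using assms(3) by simp
  moreover have "z (Suc t) = x - xs"
    by (simp add: z_def x_def)
  ultimately show ?thesis
    using mult_left_mono[OF sector_minimizer_gradient_ball[OF assms(1,2), of x] assms(3)]
    by (simp add: mult.assoc)
qed

lemma globally_asymptotically_converges_if_geometric:
  fixes X :: "'a::real_normed_vector \<Rightarrow> 'a \<Rightarrow> nat \<Rightarrow> 'a"
  assumes "0 < K" and "0 \<le> q" and "q < 1"
    and decay: "\<And>a b t. (norm (X a b t - xs))\<^sup>2 \<le>
      K * q ^ t * ((norm (a - xs))\<^sup>2 + (norm (b - xs))\<^sup>2)"
  shows "globally_asymptotically_converges X xs"
  unfolding globally_asymptotically_converges_def
proof (intro conjI allI impI)
  fix \<epsilon> :: real
  assume "0 < \<epsilon>"
  define \<delta> where "\<delta> = \<epsilon> / sqrt (2 * K)"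
  have "0 < \<delta>"
    using \<open>0 < \<epsilon>\<close> \<open>0 < K\<close> by (simp add: \<delta>_def)
  moreover have "norm (X a b t - xs) < \<epsilon>"
    if "norm (b - xs) < \<delta>" and "norm (a - xs) < \<delta>" for a b t
  proof (rule power2_less_imp_less)
    have "(norm (a - xs))\<^sup>2 < \<delta>\<^sup>2" and "(norm (b - xs))\<^sup>2 < \<delta>\<^sup>2"
      using that by (auto intro!: power_strict_mono)
    then have "K * ((norm (a - xs))\<^sup>2 + (norm (b - xs))\<^sup>2) < K * (2 * \<delta>\<^sup>2)"
      using \<open>0 < K\<close> by (intro mult_strict_left_mono) auto
    moreover have "K * q ^ t * ((norm (a - xs))\<^sup>2 + (norm (b - xs))\<^sup>2)
        \<le> K * 1 * ((norm (a - xs))\<^sup>2 + (norm (b - xs))\<^sup>2)"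
      using assms(1-3) by (intro mult_right_mono mult_left_mono power_le_one) auto
    moreover have "K * (2 * \<delta>\<^sup>2) = \<epsilon>\<^sup>2"
      using \<open>0 < K\<close> by (simp add: \<delta>_def power_divide)
    ultimately show "(norm (X a b t - xs))\<^sup>2 < \<epsilon>\<^sup>2"
      using decay[of a b t] by linarith
  qed (use \<open>0 < \<epsilon>\<close> in simp)
  ultimately show "\<exists>\<delta>>0. \<forall>a b. norm (b - xs) < \<delta> \<longrightarrow> norm (a - xs) < \<delta> \<longrightarrow>
      (\<forall>t. norm (X a b t - xs) < \<epsilon>)"
    by blast
next
  fix S :: "('a \<times> 'a) set"
  assume "bounded S"
  then obtain R where R: "\<And>s. s \<in> S \<Longrightarrow> norm (s - (xs, xs)) \<le> R"
    unfolding bounded_any_center[where a="(xs, xs)"] by (auto simp: dist_norm norm_minus_commute)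
  have bound: "(norm (X a b t - xs))\<^sup>2 \<le> K * R\<^sup>2 * q ^ t" if "(a, b) \<in> S" for a b t
  proof -
    have "norm ((a, b) - (xs, xs)) \<le> R"
      using R that by blast
    then have "(norm ((a, b) - (xs, xs)))\<^sup>2 \<le> R\<^sup>2"
      by (intro power_mono) auto
    then have "(norm (a - xs))\<^sup>2 + (norm (b - xs))\<^sup>2 \<le> R\<^sup>2"
      by (simp add: norm_Pair)
    then have "K * q ^ t * ((norm (a - xs))\<^sup>2 + (norm (b - xs))\<^sup>2) \<le> K * q ^ t * R\<^sup>2"
      using assms by (intro mult_left_mono) auto
    with decay[of a b t] show ?thesis
      by (simp add: mult_ac)
  qed
  have lim: "(\<lambda>t. K * R\<^sup>2 * q ^ t) \<longlonglongrightarrow> 0"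
    using assms by (intro tendsto_mult_right_zero LIMSEQ_power_zero) auto
  show "uniform_limit S (\<lambda>t (a, b). norm (X a b t - xs)) (\<lambda>_. 0) sequentially"
  proof (rule uniform_limitI)
    fix \<epsilon> :: real
    assume "0 < \<epsilon>"
    then have "\<forall>\<^sub>F t in sequentially. K * R\<^sup>2 * q ^ t < \<epsilon>\<^sup>2"
      by (intro order_tendstoD(2)[OF lim]) simp
    then show "\<forall>\<^sub>F t in sequentially.
        \<forall>s\<in>S. dist ((\<lambda>(a, b). norm (X a b t - xs)) s) 0 < \<epsilon>"
    proof eventually_elim
      case (elim t)
      have "norm (X a b t - xs) < \<epsilon>" if "(a, b) \<in> S" for a b
        using power2_less_imp_less[OF le_less_trans[OF bound[OF that] elim]] \<open>0 < \<epsilon>\<close> by simp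
      then show ?case
        by (auto simp: dist_norm)
    qed
  qed
qed

theorem theorem3:
  fixes m L \<alpha> \<beta> :: real and f :: "real ^ 'n \<Rightarrow> real" and xs :: "real ^ 'n"
  assumes "0 < m" and "m < L"
    and "0 \<le> \<beta>" and "\<beta> < 1"
    and "0 < \<alpha>" and "\<alpha> < alpha_bar m L \<beta>"
    and "f \<in> sector_class m L" and "sector_minimizer m L f xs"
  shows "globally_asymptotically_converges (heavy_ball \<alpha> \<beta> f) xs"
proof -
  define c \<rho> where "c = 1 + \<beta> - \<alpha> * ((L + m) / 2)" and "\<rho> = \<alpha> * ((L - m) / 2)"
  have "0 \<le> \<rho>"
    using assms by (simp add: \<rho>_def)
  from perturbed_recurrence_geometric_decay[OF assms(3,4) this
      frequency_condition[OF assms(1-6), folded c_def \<rho>_def], where 'a="real ^ 'n"]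
  obtain K q where "0 < K" "0 \<le> q" "q < 1"
    and decay: "\<And>(z :: nat \<Rightarrow> real ^ 'n) t.
      (\<And>t. norm (z (Suc (Suc t)) - c *\<^sub>R z (Suc t) + \<beta> *\<^sub>R z t) \<le> \<rho> * norm (z (Suc t))) \<Longrightarrow>
      (norm (z (Suc t)))\<^sup>2 \<le> K * q ^ t * ((norm (z 1))\<^sup>2 + (norm (z 0))\<^sup>2)"
    by blast
  show ?thesis
  proof (rule globally_asymptotically_converges_if_geometric)
    fix a b :: "real ^ 'n" and t
    let ?z = "\<lambda>t. (case t of 0 \<Rightarrow> b | Suc s \<Rightarrow> heavy_ball \<alpha> \<beta> f a b s) - xs"
    have "norm (?z (Suc (Suc t)) - c *\<^sub>R ?z (Suc t) + \<beta> *\<^sub>R ?z t) \<le> \<rho> * norm (?z (Suc t))" for t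
      unfolding c_def \<rho>_def using assms by (intro heavy_ball_perturbed_recurrence) auto
    from decay[of ?z, OF this, of t]
    show "(norm (heavy_ball \<alpha> \<beta> f a b t - xs))\<^sup>2 \<le>
        K * q ^ t * ((norm (a - xs))\<^sup>2 + (norm (b - xs))\<^sup>2)"
      by simp
  qed fact+
qed

end
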